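(* Let $a>0$ be a real number. For every integer $n\ge 1$, $$\frac{1}{2(n+a)}+\frac{\alpha_3}{(n+a)^2}\le \gamma(a)-x_n<\frac{1}{2(n+a)}+\frac{\beta_3}{(n+a)^2},$$ $$\frac{1}{2(n+a-1)}+\frac{\alpha_4}{(n+a-1)^2}<y_n-\gamma(a)\le\frac{1}{2(n+a-1)}+\frac{\beta_4}{(n+a-1)^2},$$ with the best possible constants $$\alpha_3=(1+a)^2\,[\ln(1+a)-\psi(1+a)]-\frac{1+a}{2},\qquad \beta_3=\frac1{12},$$ $$\alpha_4=-\frac1{12},\qquad \beta_4=a^2\,[\psi(a)-\ln a]+\frac a2 .$$
   Context: For real $a>0$ and integer $n\ge 1$ define $$x_n=\frac1a+\frac1{a+1}+\cdots+\frac1{a+n-1}-\ln\frac{a+n}{a},\qquad y_n=\frac1a+\frac1{a+1}+\cdots+\frac1{a+n-1}-\ln\frac{a+n-1}{a}.$$ The generalized Euler-Mascheroni constant is $\gamma(a)=\lim_{n\to\infty}y_n$. The psi (digamma) function is $\psi(x)=\Gamma'(x)/\Gamma(x)$ for $x>0$, where $\Gamma$ is the gamma function. "Best possible" is understood for each fixed $a>0$: the lower bound does not hold for all integers $n\ge1$ if the constant $\alpha_i$ is replaced by any larger real number, and the upper bound does not hold for all integers $n\ge1$ if the constant $\beta_i$ is replaced by any smaller real number. *)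

theory Defs
  imports "HOL-Analysis.Analysis"
begin

text \<open>
  The two sequences are meant for \<open>a > 0\<close> and \<open>n \<ge> 1\<close>; the junk value at \<open>n = 0\<close>
  affects neither the limit below nor any statement restricted to \<open>n \<ge> 1\<close>.
\<close>

definition euler_x :: "real \<Rightarrow> nat \<Rightarrow> real" where
  "euler_x a n = (\<Sum>k<n. 1 / (a + real k)) - ln ((a + real n) / a)"

definition euler_y :: "real \<Rightarrow> nat \<Rightarrow> real" where
  "euler_y a n = (\<Sum>k<n. 1 / (a + real k)) - ln ((a + real n - 1) / a)"

definition gen_euler_mascheroni :: "real \<Rightarrow> real" where
  "gen_euler_mascheroni a = lim (euler_y a)"

text \<open>
  \<open>lim\<close> is total, so convergence of the defining sequence is recorded separately.
\<close>

lemma euler_y_tendsto: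
  assumes "a > 0"
  shows "euler_y a \<longlonglongrightarrow> gen_euler_mascheroni a"
proof -
  have nz: "a \<noteq> 0" using assms by simp
  have 1: "(\<lambda>m. ln (real m) - (\<Sum>n<m. inverse (a + real n))) \<longlonglongrightarrow> Digamma a"
    using Digamma_LIMSEQ[OF nz] by simp
  have "(\<lambda>m. ln ((a + real m - 1) / real m)) \<longlonglongrightarrow> ln 1"
  proof (rule tendsto_ln)
    have "(\<lambda>m. 1 + (a - 1) * (1 / real m)) \<longlonglongrightarrow> 1 + (a - 1) * 0"
      by (intro tendsto_intros lim_1_over_n)
    moreover have "eventually (\<lambda>m. 1 + (a - 1) * (1 / real m) = (a + real m - 1) / real m) sequentially"
      using eventually_gt_at_top[of 0] by eventually_elim (simp add: field_simps)
    ultimately show "(\<lambda>m. (a + real m - 1) / real m) \<longlonglongrightarrow> 1"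
      by (simp cong: filterlim_cong add: tendsto_cong)
  qed simp
  from tendsto_diff[OF tendsto_diff[OF tendsto_const[of "ln a"] 1] this]
  have "(\<lambda>m. ln a - (ln (real m) - (\<Sum>n<m. inverse (a + real n)))
           - ln ((a + real m - 1) / real m)) \<longlonglongrightarrow> ln a - Digamma a" by simp
  moreover have "eventually (\<lambda>m. ln a - (ln (real m) - (\<Sum>n<m. inverse (a + real n)))
           - ln ((a + real m - 1) / real m) = euler_y a m) sequentially"
    using eventually_gt_at_top[of 0]
  proof eventually_elim
    case (elim m)
    then have "a + real m - 1 > 0" using assms by linarith
    with elim assms show ?case
      by (simp add: euler_y_def ln_div inverse_eq_divide)
  qed
  ultimately have "euler_y a \<longlonglongrightarrow> ln a - Digamma a"
    by (simp add: tendsto_cong)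
  then show ?thesis
    by (simp add: gen_euler_mascheroni_def limI)
qed

text \<open>
  The psi function is the library's \<^const>\<open>Polygamma\<close> of order 0; on the positive
  reals it is the logarithmic derivative of the Gamma function.
\<close>

lemma Digamma_eq_deriv_Gamma:
  fixes x :: real
  assumes "x > 0"
  shows "Digamma x = deriv Gamma x / Gamma x"
proof -
  have "x \<notin> \<int>\<^sub>\<le>\<^sub>0" using assms by (auto elim!: nonpos_Ints_cases)
  then have "deriv Gamma x = Gamma x * Digamma x"
    by (intro DERIV_imp_deriv has_field_derivative_Gamma)
  with Gamma_real_pos[OF assms] show ?thesis by simp
qed

definition alpha3 :: "real \<Rightarrow> real" where
  "alpha3 a = (1 + a)^2 * (ln (1 + a) - Digamma (1 + a)) - (1 + a) / 2"

definition beta3 :: real where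
  "beta3 = 1 / 12"

definition alpha4 :: real where
  "alpha4 = - 1 / 12"

definition beta4 :: "real \<Rightarrow> real" where
  "beta4 a = a^2 * (Digamma a - ln a) + a / 2"

end

theory Submission
  imports Defs "HOL-Real_Asymp.Real_Asymp"
begin

text \<open>
  Put $f(x) = x^2 (\ln x - \psi(x)) - x/2$. Then $\gamma(a) - x_n$ and $y_n - \gamma(a)$ equal
  $1/(2t) + f(t)/t^2$ at $t = n + a$ and $1/(2t) - f(t)/t^2$ at $t = n + a - 1$, so everything follows
  from $f(x) < f(x+1)$ and $f(x) \to 1/12$. Both are obtained by differencing once more, since the
  recurrence for $\psi$ removes it from the increments: a function whose increments over unit steps
  are positive lies below its limit. For $f(x) < f(x+1)$ this is applied to
  $-(f(x+1) - f(x))/(2x+1)$; with $t = 1/(x+1)$ the claim on its increments becomes an inequality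
  between logarithms on $(0,1)$.
\<close>

section \<open>Limits along unit steps and shifts of the digamma function\<close>

text \<open>The values from \<open>b + 1\<close> on increase to \<open>L\<close>, so
  \<open>h (b + 1)\<close> is at most \<open>L\<close>; the first step, from \<open>b\<close> to
  \<open>b + 1\<close>, supplies the strictness.\<close>

lemma less_lim_if_shift_increasing:
  fixes h :: "real \<Rightarrow> real"
  assumes incr: "\<And>x. x \<ge> b \<Longrightarrow> h x < h (x + 1)"
    and lim: "(\<lambda>n. h (b + real n)) \<longlonglongrightarrow> L"
  shows "h b < L"
proof -
  have "incseq (\<lambda>n. h (b + 1 + real n))"
    using incr[of "b + 1 + real n" for n]
    by (intro incseq_SucI less_imp_le) (simp add: add_ac)
  moreover have "(\<lambda>n. h (b + 1 + real n)) \<longlonglongrightarrow> L"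
    using LIMSEQ_Suc[OF lim] by (simp add: add_ac)
  ultimately have "h (b + 1 + real 0) \<le> L"
    by (rule incseq_le)
  with incr[of b] show ?thesis by simp
qed

lemma Digamma_plus_nat:
  fixes x :: real
  assumes "x > 0"
  shows "Digamma (x + real m) = Digamma x + (\<Sum>k<m. 1 / (x + real k))"
proof (induction m)
  case (Suc m)
  then show ?case
    using Digamma_plus1[of "x + real m"] assms by (simp add: add_ac)
qed simp

lemma ln_minus_Digamma_tendsto:
  fixes x :: real
  assumes "x > 0"
  shows "(\<lambda>n. ln (x + real n) - Digamma (x + real n)) \<longlonglongrightarrow> 0"
proof -
  have "(\<lambda>m. ln (real m) - (\<Sum>k<m. inverse (x + real k))) \<longlonglongrightarrow> Digamma x"
    using Digamma_LIMSEQ[of x] assms by simp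
  moreover have "(\<lambda>m. ln (x + real m) - ln (real m)) \<longlonglongrightarrow> 0"
    by real_asymp
  ultimately have "(\<lambda>m. (ln (x + real m) - ln (real m))
      + (ln (real m) - (\<Sum>k<m. inverse (x + real k))) - Digamma x) \<longlonglongrightarrow> 0 + Digamma x - Digamma x"
    by (intro tendsto_intros)
  then show ?thesis by (simp add: Digamma_plus_nat[OF assms] inverse_eq_divide algebra_simps)
qed

section \<open>The second-order remainder of the digamma function and its limit\<close>

text \<open>The function \<open>f\<close> of the overview: what is left of
  \<open>ln x - Digamma x\<close> after its leading term \<open>1 / (2 * x)\<close>, rescaled by
  \<open>x^2\<close>.\<close>

definition digamma_rem :: "real \<Rightarrow> real" where
  "digamma_rem x = x^2 * (ln x - Digamma x) - x / 2"

lemma Digamma_eq_digamma_rem: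
  assumes "x > 0"
  shows "ln x - Digamma x = 1 / (2 * x) + digamma_rem x / x^2"
  using assms by (simp add: digamma_rem_def field_simps power2_eq_square)

text \<open>Here \<open>g\<close> is the error of the expansion with a trial coefficient
  \<open>c\<close> of \<open>1 / x^2\<close>. The recurrence contributes \<open>- 1 / x\<close>,
  half of which cancels against \<open>1 / (2 * x)\<close>, leaving elementary functions
  only.\<close>

lemma Digamma_error_shift_diff:
  fixes x c :: real
  assumes "x > 0"
  defines "g \<equiv> \<lambda>x. ln x - Digamma x - 1 / (2 * x) - c / x^2"
  shows "g (x + 1) - g x
    = ln (x + 1) - ln x - 1 / (2 * x) - 1 / (2 * (x + 1)) + c / x^2 - c / (x + 1)^2"
proof -
  have "Digamma (x + 1) = Digamma x + 1 / x"
    using Digamma_plus1[of x] assms by simp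
  moreover have "1 / x = 2 * (1 / (2 * x))"
    by simp
  ultimately show ?thesis
    unfolding g_def by linarith
qed

lemma Digamma_error_tendsto_0:
  fixes x c :: real
  assumes "x > 0"
  shows "(\<lambda>n. ln (x + real n) - Digamma (x + real n) - 1 / (2 * (x + real n)) - c / (x + real n)^2) \<longlonglongrightarrow> 0"
proof -
  have "(\<lambda>n. 1 / (2 * (x + real n)) + c / (x + real n)^2) \<longlonglongrightarrow> 0"
    by real_asymp
  from tendsto_diff[OF ln_minus_Digamma_tendsto[OF assms] this] show ?thesis
    by (simp add: algebra_simps)
qed

text \<open>Each trial coefficient \<open>c\<close> other than 1/12 gives an error
  \<open>g c\<close> that is eventually monotone over unit steps and tends to 0. Its sign is
  therefore known, and it decides on which side of \<open>c\<close> the remainder lies.\<close>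

lemma digamma_rem_tendsto: "(digamma_rem \<longlongrightarrow> 1 / 12) at_top"
proof -
  \<comment> \<open>\<open>p\<close> is the trapezoidal error for \<open>1 / t\<close> on
    \<open>[x, x + 1]\<close>, asymptotic to \<open>- 1 / (6 * x^3)\<close>, and \<open>d\<close> is
    asymptotic to \<open>2 / x^3\<close>. Hence \<open>p + c * d\<close> changes its eventual sign
    at \<open>c = 1 / 12\<close>.\<close>
  define p where "p = (\<lambda>x::real. ln (x + 1) - ln x - 1 / (2 * x) - 1 / (2 * (x + 1)))"
  define d where "d = (\<lambda>x::real. 1 / x^2 - 1 / (x + 1)^2)"
  have "((\<lambda>x. x^3 * p x) \<longlongrightarrow> - 1 / 6) at_top" "((\<lambda>x. x^3 * d x) \<longlongrightarrow> 2) at_top"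
    unfolding p_def d_def by real_asymp+
  then have "((\<lambda>x. x^3 * p x + c * (x^3 * d x)) \<longlongrightarrow> - 1 / 6 + c * 2) at_top" for c
    by (intro tendsto_intros)
  then have lim: "((\<lambda>x. x^3 * (p x + c * d x)) \<longlongrightarrow> - 1 / 6 + c * 2) at_top" for c
    by (simp add: algebra_simps)
  define g where "g = (\<lambda>c x::real. ln x - Digamma x - 1 / (2 * x) - c / x^2)"
  have g_lim: "(\<lambda>n. g c (x + real n)) \<longlonglongrightarrow> 0" if "x > 0" for c x
    unfolding g_def using that by (rule Digamma_error_tendsto_0)
  have g_incr: "g c (x + 1) - g c x = p x + c * d x" if "x > 0" for c x
    using Digamma_error_shift_diff[OF that, of c] by (simp add: g_def p_def d_def right_diff_distrib)
  have rem: "digamma_rem x = c + g c x * x^2" if "x > 0" for c x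
    using that by (simp add: digamma_rem_def g_def field_simps power2_eq_square)
  show ?thesis
  proof (rule order_tendstoI)
    fix c :: real assume "c < 1 / 12"
    then have "eventually (\<lambda>x. x^3 * (p x + c * d x) < 0) at_top"
      by (intro order_tendstoD(2)[OF lim]) simp
    then obtain N where N: "\<And>x. x \<ge> N \<Longrightarrow> x^3 * (p x + c * d x) < 0"
      unfolding eventually_at_top_linorder by blast
    show "eventually (\<lambda>x. c < digamma_rem x) at_top"
      using eventually_ge_at_top[of "max 1 N"]
    proof eventually_elim
      case (elim x)
      \<comment> \<open>For \<open>c\<close> below 1/12 the error \<open>g c\<close> decreases to 0
        over unit steps, so it is positive and \<open>c + g c x * x^2\<close> exceeds
        \<open>c\<close>.\<close>
      have "- g c x < 0"
      proof (rule less_lim_if_shift_increasing[of x "\<lambda>x. - g c x" 0])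
        show "- g c y < - g c (y + 1)" if "y \<ge> x" for y
          using that elim N[of y] g_incr[of y c] by (simp add: mult_less_0_iff)
        show "(\<lambda>n. - g c (x + real n)) \<longlonglongrightarrow> 0"
          using tendsto_minus[OF g_lim[of x c]] elim by simp
      qed
      with elim show ?case by (simp add: rem[of x c])
    qed
  next
    fix c :: real assume "1 / 12 < c"
    then have "eventually (\<lambda>x. x^3 * (p x + c * d x) > 0) at_top"
      by (intro order_tendstoD(1)[OF lim]) simp
    then obtain N where N: "\<And>x. x \<ge> N \<Longrightarrow> x^3 * (p x + c * d x) > 0"
      unfolding eventually_at_top_linorder by blast
    show "eventually (\<lambda>x. digamma_rem x < c) at_top"
      using eventually_ge_at_top[of "max 1 N"]
    proof eventually_elim
      case (elim x)
      have "g c x < 0"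
      proof (rule less_lim_if_shift_increasing[of x "g c" 0])
        show "g c y < g c (y + 1)" if "y \<ge> x" for y
          using that elim N[of y] g_incr[of y c] by (simp add: zero_less_mult_iff)
        show "(\<lambda>n. g c (x + real n)) \<longlonglongrightarrow> 0"
          using g_lim[of x c] elim by simp
      qed
      with elim show ?case by (simp add: rem[of x c] mult_neg_pos)
    qed
  qed
qed

section \<open>The logarithmic inequality behind monotonicity\<close>

text \<open>The left side vanishes at 0 and its derivative is \<open>(1 - t^2) * K t\<close>, where
  \<open>K\<close> is the function in \<open>*\<close>. Dividing by \<open>1 - t^2\<close> makes the
  coefficient of the logarithms constant, so one more derivative removes them: \<open>K\<close>
  vanishes at 0 and has derivative \<open>- (4 * t^4 / (1 - t^2)^2)\<close>.\<close>

lemma ln_one_plus_minus_ineq: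
  fixes t :: real
  assumes "0 < t" "t < 1"
  shows "2 * ln (1 - t^2) + (3 * t - t^3) * (ln (1 + t) - ln (1 - t)) - 4 * t^2 + t^4 < 0"
proof -
  have *: "3 * (ln (1 + s) - ln (1 - s)) - 4 * s - 2 * s / (1 - s^2) < 0"
    (is "?K s < 0") if s: "0 < s" "s < 1" for s :: real
  proof -
    have "?K s < ?K 0"
    proof (rule DERIV_neg_imp_decreasing_open[OF s(1)])
      fix x assume x: "0 < x" "x < s"
      with s have "x^2 < 1" by (simp add: power_less_one_iff)
      then have nz: "1 - x^2 \<noteq> 0" by simp
      have "(?K has_real_derivative 3 * (1 / (1 + x) + 1 / (1 - x)) - 4
           - (2 * (1 - x^2) - 2 * x * (- (2 * x))) / (1 - x^2)^2) (at x)"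
        using x s nz by (auto intro!: derivative_eq_intros simp: power2_eq_square)
      moreover have "1 / (1 + x) + 1 / (1 - x) = 2 / (1 - x^2)"
        using x s nz by (simp add: field_simps power2_eq_square)
      moreover have "3 * (2 / (1 - x^2)) - 4 - (2 * (1 - x^2) - 2 * x * (- (2 * x))) / (1 - x^2)^2
          = - (4 * x^4 / (1 - x^2)^2)"
        using nz by (simp add: divide_simps) algebra
      moreover have "4 * x^4 / (1 - x^2)^2 > 0"
        using x nz by (intro divide_pos_pos) auto
      ultimately show "\<exists>y. (?K has_real_derivative y) (at x) \<and> y < 0"
        by auto
    next
      have "1 - x^2 \<noteq> 0" if "x \<in> {0..s}" for x
      proof -
        have "x^2 < 1" using that s by (simp add: power_less_one_iff)
        then show ?thesis by simp
      qed
      with s show "continuous_on {0..s} ?K"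
        by (auto intro!: continuous_intros)
    qed
    then show ?thesis by simp
  qed
  let ?H = "\<lambda>t. 2 * ln (1 - t^2) + (3 * t - t^3) * (ln (1 + t) - ln (1 - t)) - 4 * t^2 + t^4"
  have "?H t < ?H 0"
  proof (rule DERIV_neg_imp_decreasing_open[OF assms(1)])
    fix x assume x: "0 < x" "x < t"
    with assms have "x^2 < 1" by (simp add: power_less_one_iff)
    then have pos: "1 - x^2 > 0" by simp
    have "(?H has_real_derivative - 4 * x / (1 - x^2) + (3 - 3 * x^2) * (ln (1 + x) - ln (1 - x))
        + (3 * x - x^3) * (1 / (1 + x) + 1 / (1 - x)) - 8 * x + 4 * x^3) (at x)"
      using x assms pos by (auto intro!: derivative_eq_intros)
    moreover have "1 / (1 + x) + 1 / (1 - x) = 2 / (1 - x^2)"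
      using x assms pos by (simp add: field_simps power2_eq_square)
    moreover have "- 4 * x / (1 - x^2) + (3 - 3 * x^2) * (ln (1 + x) - ln (1 - x))
        + (3 * x - x^3) * (2 / (1 - x^2)) - 8 * x + 4 * x^3 = (1 - x^2) * ?K x"
      using pos by (simp add: divide_simps) algebra
    moreover have "(1 - x^2) * ?K x < 0"
      using pos *[of x] x assms by (intro mult_pos_neg) auto
    ultimately show "\<exists>y. (?H has_real_derivative y) (at x) \<and> y < 0"
      by auto
  next
    have "1 - x^2 \<noteq> 0" if "x \<in> {0..t}" for x
    proof -
      have "x^2 < 1" using that assms by (simp add: power_less_one_iff)
      then show ?thesis by simp
    qed
    with assms show "continuous_on {0..t} ?H"
      by (auto intro!: continuous_intros)
  qed
  then show ?thesis by simp
qed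

text \<open>This is what remains of the decrease of \<open>digamma_rem_slope\<close> over a unit
  step once the denominators \<open>2 * x + 1\<close> and \<open>2 * x + 3\<close> are cleared. It
  is the preceding inequality at \<open>t = 1 / (x + 1)\<close>, multiplied by
  \<open>(x + 1)^3\<close>.\<close>

lemma weighted_ln_second_difference_less:
  fixes x :: real
  assumes "x > 0"
  shows "(2 * x + 1) * ((x + 2)^2 * ln (x + 2) - (x + 1)^2 * ln (x + 1))
      - (2 * x + 3) * ((x + 1)^2 * ln (x + 1) - x^2 * ln x)
      < 4 * (x + 1) - 1 / (x + 1)"
proof -
  define u where "u = x + 1"
  define p where "p = ln (x + 2) - ln u"
  define q where "q = ln x - ln u"
  have u: "u > 1" using assms by (simp add: u_def)
  have "1 + 1 / u = (x + 2) / u"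
    using u by (simp add: u_def field_simps)
  then have p: "ln (1 + 1 / u) = p"
    using assms u by (simp add: p_def ln_div)
  have "1 - 1 / u = x / u"
    using u by (simp add: u_def field_simps)
  then have q: "ln (1 - 1 / u) = q"
    using assms u by (simp add: q_def ln_div)
  have "1 - (1 / u)^2 = (1 + 1 / u) * (1 - 1 / u)"
    by (simp add: algebra_simps power2_eq_square)
  also have "ln \<dots> = p + q"
    using u p q by (subst ln_mult_pos) (auto simp: add_pos_pos)
  finally have "2 * (p + q) + (3 * (1 / u) - (1 / u)^3) * (p - q) - 4 * (1 / u)^2 + (1 / u)^4 < 0"
    using ln_one_plus_minus_ineq[of "1 / u"] u p q by simp
  then have "u^3 * (2 * (p + q) + (3 * (1 / u) - (1 / u)^3) * (p - q) - 4 * (1 / u)^2 + (1 / u)^4) < 0"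
    using u by (intro mult_pos_neg) auto
  also have "u^3 * (2 * (p + q) + (3 * (1 / u) - (1 / u)^3) * (p - q) - 4 * (1 / u)^2 + (1 / u)^4)
      = 2 * u^3 * (p + q) + (3 * u^2 - 1) * (p - q) - 4 * u + 1 / u"
    using u by (simp add: divide_simps) algebra
  \<comment> \<open>The coefficients of \<open>ln (x + 2)\<close>, \<open>ln u\<close> and
    \<open>ln x\<close> are \<open>2 * u^3 + 3 * u^2 - 1\<close>, \<open>- 4 * u^3\<close> and
    \<open>2 * u^3 - 3 * u^2 + 1\<close>. They sum to 0, so \<open>ln u\<close> may be subtracted
    from each logarithm.\<close>
  also have "2 * u^3 * (p + q) + (3 * u^2 - 1) * (p - q)
      = (2 * x + 1) * ((x + 2)^2 * ln (x + 2) - (x + 1)^2 * ln (x + 1))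
      - (2 * x + 3) * ((x + 1)^2 * ln (x + 1) - x^2 * ln x)"
    unfolding p_def q_def u_def by algebra
  finally show ?thesis by (simp add: u_def)
qed

section \<open>Monotonicity of the remainder over unit steps\<close>

text \<open>The divisor is \<open>(x + 1)^2 - x^2\<close>, up to sign the coefficient of
  \<open>Digamma x\<close> in the increment. After division that coefficient is the constant -1, so
  a further unit difference eliminates \<open>Digamma\<close>.\<close>

definition digamma_rem_slope :: "real \<Rightarrow> real" where
  "digamma_rem_slope x = (digamma_rem (x + 1) - digamma_rem x) / (2 * x + 1)"

lemma digamma_rem_slope_eq:
  assumes "x > 0"
  shows "digamma_rem_slope x
    = ((x + 1)^2 * ln (x + 1) - x^2 * ln x - (x + 1)^2 / x - 1 / 2) / (2 * x + 1) - Digamma x"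
proof -
  have "Digamma (x + 1) = Digamma x + 1 / x"
    using Digamma_plus1[of x] assms by simp
  then show ?thesis
    using assms unfolding digamma_rem_slope_def digamma_rem_def
    by (simp add: divide_simps) algebra
qed

lemma digamma_rem_slope_shift_less:
  assumes y: "y > 0"
  shows "digamma_rem_slope (y + 1) < digamma_rem_slope y"
proof -
  have psi: "Digamma (y + 1) = Digamma y + 1 / y"
    using Digamma_plus1[of y] y by simp
  define A where "A = (y + 2)^2 * ln (y + 2) - (y + 1)^2 * ln (y + 1)"
  define B where "B = (y + 1)^2 * ln (y + 1) - y^2 * ln y"
  have "digamma_rem_slope (y + 1)
      = (A - (y + 2)^2 / (y + 1) - 1 / 2) / (2 * y + 3) - Digamma y - 1 / y"
    using y psi by (simp add: digamma_rem_slope_eq A_def add_ac)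
  moreover have "digamma_rem_slope y = (B - (y + 1)^2 / y - 1 / 2) / (2 * y + 1) - Digamma y"
    using y by (simp add: digamma_rem_slope_eq B_def)
  ultimately have "digamma_rem_slope (y + 1) - digamma_rem_slope y
      = ((2 * y + 1) * A - (2 * y + 3) * B - (4 * (y + 1) - 1 / (y + 1))) / ((2 * y + 1) * (2 * y + 3))"
    using y by (simp add: divide_simps) algebra
  moreover have "(2 * y + 1) * A - (2 * y + 3) * B < 4 * (y + 1) - 1 / (y + 1)"
    unfolding A_def B_def by (rule weighted_ln_second_difference_less[OF y])
  ultimately have "digamma_rem_slope (y + 1) - digamma_rem_slope y < 0"
    using y by (simp add: divide_neg_pos)
  then show ?thesis by simp
qed

lemma digamma_rem_seq:
  assumes "a > 0"
  shows "strict_mono (\<lambda>n. digamma_rem (a + real n))"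
    and "(\<lambda>n. digamma_rem (a + real n)) \<longlonglongrightarrow> 1 / 12"
proof -
  have lim: "(\<lambda>n. digamma_rem (x + real n)) \<longlonglongrightarrow> 1 / 12" for x
    by (rule filterlim_compose[OF digamma_rem_tendsto]) real_asymp
  have slope_lim: "(\<lambda>n. - digamma_rem_slope (x + real n)) \<longlonglongrightarrow> 0" for x
  proof -
    have "(\<lambda>n. 1 / (2 * (x + real n) + 1)) \<longlonglongrightarrow> 0" by real_asymp
    with lim[of x] lim[of "x + 1"]
    have "(\<lambda>n. - ((digamma_rem (x + 1 + real n) - digamma_rem (x + real n))
        * (1 / (2 * (x + real n) + 1)))) \<longlonglongrightarrow> - ((1 / 12 - 1 / 12) * 0)"
      by (intro tendsto_minus tendsto_mult tendsto_diff)
    then show ?thesis by (simp add: digamma_rem_slope_def add_ac)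
  qed
  have "digamma_rem x < digamma_rem (x + 1)" if "x > 0" for x
  proof -
    \<comment> \<open>The negated slope increases to 0 over unit steps, so the slope, and with it
      the increment of \<open>digamma_rem\<close>, is positive.\<close>
    have "- digamma_rem_slope x < 0"
      using that slope_lim
      by (intro less_lim_if_shift_increasing[of x "\<lambda>x. - digamma_rem_slope x" 0])
         (auto intro: digamma_rem_slope_shift_less)
    with that show ?thesis by (simp add: digamma_rem_slope_def zero_less_divide_iff)
  qed
  from this[of "a + real n" for n] assms
  show "strict_mono (\<lambda>n. digamma_rem (a + real n))"
    by (simp add: strict_mono_Suc_iff add_ac)
  show "(\<lambda>n. digamma_rem (a + real n)) \<longlonglongrightarrow> 1 / 12"
    by (rule lim)
qed

section \<open>The two Euler sequences in terms of the remainder\<close>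

lemma euler_x_eq:
  assumes "a > 0"
  shows "euler_x a n = ln a - Digamma a - (ln (a + real n) - Digamma (a + real n))"
  using assms by (simp add: euler_x_def Digamma_plus_nat ln_div add_pos_nonneg)

lemma gen_euler_mascheroni_eq:
  assumes "a > 0"
  shows "gen_euler_mascheroni a = ln a - Digamma a"
proof (rule LIMSEQ_unique[OF euler_y_tendsto[OF assms]])
  \<comment> \<open>\<open>euler_y\<close> is written as \<open>euler_x\<close> plus the difference
    of their logarithms, which tends to 0.\<close>
  have "(\<lambda>n. ln a - Digamma a - (ln (a + real n) - Digamma (a + real n))
      + (ln ((a + real n) / a) - ln ((a + real n - 1) / a))) \<longlonglongrightarrow> ln a - Digamma a - 0 + 0"
  proof (intro tendsto_intros ln_minus_Digamma_tendsto[OF assms])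
    show "(\<lambda>n. ln ((a + real n) / a) - ln ((a + real n - 1) / a)) \<longlonglongrightarrow> 0"
      using assms by real_asymp
  qed
  then show "euler_y a \<longlonglongrightarrow> ln a - Digamma a"
    by (simp add: euler_x_eq[OF assms, symmetric]) (simp add: euler_x_def euler_y_def[abs_def])
qed

lemma gen_euler_mascheroni_minus_euler_x:
  assumes "a > 0"
  shows "gen_euler_mascheroni a - euler_x a n
    = 1 / (2 * (real n + a)) + digamma_rem (a + real n) / (real n + a)^2"
  using assms Digamma_eq_digamma_rem[of "a + real n"]
  by (simp add: gen_euler_mascheroni_eq euler_x_eq add_ac)

text \<open>The index is shifted because \<open>euler_y a (Suc n)\<close> has the same logarithm as
  \<open>euler_x a n\<close> and one more summand \<open>1 / (n + a)\<close>. Subtracting the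
  formula for \<open>gen_euler_mascheroni a - euler_x a n\<close> from that summand halves it and
  flips the sign of the remainder.\<close>

lemma euler_y_minus_gen_euler_mascheroni:
  assumes "a > 0"
  shows "euler_y a (Suc n) - gen_euler_mascheroni a
    = 1 / (2 * (real n + a)) - digamma_rem (a + real n) / (real n + a)^2"
proof -
  define h where "h = 1 / (2 * (real n + a))"
  have "euler_y a (Suc n) = euler_x a n + 1 / (real n + a)"
    by (simp add: euler_x_def euler_y_def add.commute)
  moreover have "1 / (real n + a) = 2 * h"
    using assms by (simp add: h_def divide_simps)
  ultimately show ?thesis
    using gen_euler_mascheroni_minus_euler_x[OF assms, of n]
    unfolding h_def[symmetric] by linarith
qed

lemma alpha3_eq_digamma_rem: "alpha3 a = digamma_rem (a + 1)"
  by (simp add: alpha3_def digamma_rem_def add_ac)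

lemma beta4_eq_digamma_rem: "beta4 a = - digamma_rem a"
  by (simp add: beta4_def digamma_rem_def algebra_simps)

section \<open>The two-sided bounds and their sharpness\<close>

theorem theorem1p4:
  fixes a :: real
  assumes "a > 0"
  shows
    "(\<forall>n\<ge>1.
        1 / (2 * (real n + a)) + alpha3 a / (real n + a)^2
          \<le> gen_euler_mascheroni a - euler_x a n \<and>
        gen_euler_mascheroni a - euler_x a n
          < 1 / (2 * (real n + a)) + beta3 / (real n + a)^2 \<and>
        1 / (2 * (real n + a - 1)) + alpha4 / (real n + a - 1)^2
          < euler_y a n - gen_euler_mascheroni a \<and>
        euler_y a n - gen_euler_mascheroni a
          \<le> 1 / (2 * (real n + a - 1)) + beta4 a / (real n + a - 1)^2) \<and>
     (\<forall>c > alpha3 a. \<not> (\<forall>n\<ge>1.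
        1 / (2 * (real n + a)) + c / (real n + a)^2
          \<le> gen_euler_mascheroni a - euler_x a n)) \<and>
     (\<forall>c < beta3. \<not> (\<forall>n\<ge>1.
        gen_euler_mascheroni a - euler_x a n
          < 1 / (2 * (real n + a)) + c / (real n + a)^2)) \<and>
     (\<forall>c > alpha4. \<not> (\<forall>n\<ge>1.
        1 / (2 * (real n + a - 1)) + c / (real n + a - 1)^2
          < euler_y a n - gen_euler_mascheroni a)) \<and>
     (\<forall>c < beta4 a. \<not> (\<forall>n\<ge>1.
        euler_y a n - gen_euler_mascheroni a
          \<le> 1 / (2 * (real n + a - 1)) + c / (real n + a - 1)^2))"
proof -
  define r where "r = (\<lambda>n. digamma_rem (a + real n))"
  have "strict_mono r" and lim: "r \<longlonglongrightarrow> 1 / 12"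
    using digamma_rem_seq[OF assms] by (simp_all add: r_def)
  then have mono: "r m \<le> r n" if "m \<le> n" for m n
    using that by (simp add: strict_mono_less_eq)
  have less: "r n < 1 / 12" for n
  proof -
    have "r n < r (Suc n)"
      using \<open>strict_mono r\<close> by (simp add: strict_mono_less)
    also have "r (Suc n) \<le> 1 / 12"
      using mono lim by (intro incseq_le) (auto simp: incseq_def)
    finally show ?thesis .
  qed
  \<comment> \<open>The x-bounds at \<open>n\<close> involve \<open>r n\<close>, the y-bounds
    \<open>r (n - 1)\<close>, so the least values for \<open>n \<ge> 1\<close> are
    \<open>r 1\<close> and \<open>r 0\<close>. Both are attained at \<open>n = 1\<close>, which
    explains the non-strict inequalities.\<close>
  have r01: "alpha3 a = r 1" "beta4 a = - r 0"
    by (simp_all add: alpha3_eq_digamma_rem beta4_eq_digamma_rem r_def)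
  \<comment> \<open>The limit 1/12 is approached but never attained: this gives the sharpness of
    \<open>beta3\<close> and \<open>alpha4\<close>, whose bounds are strict.\<close>
  have exceeds: "\<exists>n\<ge>1. c < r n" if "c < 1 / 12" for c
  proof -
    have "eventually (\<lambda>n. c < r n) sequentially"
      using order_tendstoD(1)[OF lim that] .
    from eventually_conj[OF this eventually_ge_at_top[of 1]] show ?thesis
      by (auto dest: eventually_happens)
  qed
  have sq: "(real m + a)^2 > 0" for m
    using assms by (simp add: add_nonneg_pos)
  note x_eq = gen_euler_mascheroni_minus_euler_x[OF assms, folded r_def]
  note y_eq = euler_y_minus_gen_euler_mascheroni[OF assms, folded r_def]
  have x_le: "1 / (2 * (real n + a)) + c / (real n + a)^2 \<le> gen_euler_mascheroni a - euler_x a n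
      \<longleftrightarrow> c \<le> r n" for c n
    using sq[of n] by (simp add: x_eq r_def divide_le_cancel)
  have x_less: "gen_euler_mascheroni a - euler_x a n < 1 / (2 * (real n + a)) + c / (real n + a)^2
      \<longleftrightarrow> r n < c" for c n
    using sq[of n] by (simp add: x_eq r_def divide_less_cancel)
  have y_less: "1 / (2 * (real (Suc m) + a - 1)) + c / (real (Suc m) + a - 1)^2
      < euler_y a (Suc m) - gen_euler_mascheroni a \<longleftrightarrow> c < - r m" for c m
    using sq[of m] divide_less_cancel[of c "(real m + a)^2" "- r m"] by (simp add: y_eq r_def)
  have y_le: "euler_y a (Suc m) - gen_euler_mascheroni a
      \<le> 1 / (2 * (real (Suc m) + a - 1)) + c / (real (Suc m) + a - 1)^2 \<longleftrightarrow> - r m \<le> c" for c m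
    using sq[of m] divide_le_cancel[of "- r m" "(real m + a)^2" c] by (simp add: y_eq r_def)
  have all_Suc: "(\<forall>n\<ge>1. P n) \<longleftrightarrow> (\<forall>m. P (Suc m))" for P
    by (metis One_nat_def Suc_le_D Suc_le_mono le0)
  have x_bounds: "alpha3 a \<le> r n" "r n < beta3" if "n \<ge> 1" for n
    using less mono that by (auto simp: r01 beta3_def)
  have y_bounds: "alpha4 < - r m" "- r m \<le> beta4 a" for m
    using less[of m] mono[of 0 m] by (auto simp: r01 alpha4_def)
  show ?thesis
  proof (intro conjI allI impI)
    fix n :: nat assume "1 \<le> n"
    then obtain m where n: "n = Suc m" by (cases n) auto
    show "1 / (2 * (real n + a)) + alpha3 a / (real n + a)^2 \<le> gen_euler_mascheroni a - euler_x a n"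
      "gen_euler_mascheroni a - euler_x a n < 1 / (2 * (real n + a)) + beta3 / (real n + a)^2"
      using x_bounds[OF \<open>1 \<le> n\<close>] by (simp_all only: x_le x_less)
    show "1 / (2 * (real n + a - 1)) + alpha4 / (real n + a - 1)^2
        < euler_y a n - gen_euler_mascheroni a"
      "euler_y a n - gen_euler_mascheroni a
        \<le> 1 / (2 * (real n + a - 1)) + beta4 a / (real n + a - 1)^2"
      unfolding n using y_bounds by (simp_all only: y_le y_less)
  next
    fix c assume "alpha3 a < c"
    then show "\<not> (\<forall>n\<ge>1. 1 / (2 * (real n + a)) + c / (real n + a)^2
        \<le> gen_euler_mascheroni a - euler_x a n)"
      \<comment> \<open>The case \<open>n = 1\<close> would give \<open>c \<le> r 1\<close>.\<close>
      unfolding x_le r01 by (metis less_le_not_le order_refl)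
  next
    fix c assume "c < beta3"
    then show "\<not> (\<forall>n\<ge>1. gen_euler_mascheroni a - euler_x a n
        < 1 / (2 * (real n + a)) + c / (real n + a)^2)"
      unfolding x_less beta3_def using exceeds by (meson less_asym)
  next
    fix c assume "alpha4 < c"
    then have "- c < 1 / 12" by (simp add: alpha4_def)
    then obtain m where "- c < r m" using exceeds by blast
    then show "\<not> (\<forall>n\<ge>1. 1 / (2 * (real n + a - 1)) + c / (real n + a - 1)^2
        < euler_y a n - gen_euler_mascheroni a)"
      unfolding all_Suc y_less by (metis less_asym minus_less_iff)
  next
    fix c assume "c < beta4 a"
    then show "\<not> (\<forall>n\<ge>1. euler_y a n - gen_euler_mascheroni a
        \<le> 1 / (2 * (real n + a - 1)) + c / (real n + a - 1)^2)"
      \<comment> \<open>The case \<open>m = 0\<close>, that is \<open>n = 1\<close>, would give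
        \<open>- r 0 \<le> c\<close>.\<close>
      unfolding all_Suc y_le r01 by (meson not_le)
  qed
qed

end

(* 28829 *)

(* 5956 *)

(* 12486 *)

(* 26613 *)

(* 15448 *)

(* 1367 *)
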